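(* Let an instance of the network design setting ($\mathcal{N}=(N,E)$, costs $b,c$, arc lengths $d$, O/D pairs $W$, demands $g$, private utilities $u$, and $\alpha\in[0,1]$) be given, and let $\lambda\ge 1$. Then every restricted-generalized-center and every $\lambda$-restricted-cent-dian is a lexicographic cent-dian in $\mathcal{N}^\alpha$. Conversely, every lexicographic cent-dian is a restricted-generalized-center and a $\lambda$-restricted-cent-dian.
   Context: Setting. $\mathcal{N}=(N,E)$ is a finite undirected graph with node costs $b_i\ge 0$ ($i\in N$) and edge costs $c_e\ge 0$ ($e\in E$). Each edge $\{i,j\}\in E$ gives two arcs $(i,j)$ and $(j,i)$; each arc $a$ has a length $d_a\ge 0$. $W\subset N\times N$ is a finite nonempty set of origin/destination pairs $w=(w^s,w^t)$ with $w^s\ne w^t$; each $w\in W$ has a demand $g^w>0$ and a private utility $u^w>0$. Put $G=\sum_{w\in W}g^w$. Feasible subgraphs. For $\alpha\in[0,1]$, $\mathcal{N}^\alpha$ is the set of all subgraphs $\mathcal{S}=(N_{\mathcal S},E_{\mathcal S})$ of $\mathcal N$ (the empty subgraph is allowed) with $\sum_{i\in N_{\mathcal S}}b_i+\sum_{e\in E_{\mathcal S}}c_e\le \alpha\big(\sum_{i\in N}b_i+\sum_{e\in E}c_e\big)$. Lengths. For a subgraph $\mathcal S$ and $w\in W$, $d_{\mathcal S}(w)$ is the length of a shortest path from $w^s$ to $w^t$ using arcs arising from edges of $\mathcal S$, with $d_{\mathcal S}(w)=+\infty$ if no such path exists in $\mathcal{S}$; and $\ell_{\mathcal S}(w)=\min\{d_{\mathcal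 S}(w),u^w\}$. Objectives. $F_m(\mathcal S)=\frac1G\sum_{w\in W}g^w\ell_{\mathcal S}(w)$ (median objective), $F_c(\mathcal S)=\max_{w\in W}\ell_{\mathcal S}(w)$ (center objective), and, for real $\lambda\ge 0$ (values $\lambda\geq 1$ allowed), $H_\lambda(\mathcal S)=\lambda F_c(\mathcal S)+(1-\lambda)F_m(\mathcal S)$. Pareto-optimality. $\mathcal{PO}^\alpha_2$ is the set of all $\mathcal S\in\mathcal N^\alpha$ for which there is no $\mathcal S'\in\mathcal N^\alpha$ with $F_m(\mathcal S')\le F_m(\mathcal S)$ and $F_c(\mathcal S')\le F_c(\mathcal S)$, at least one of the two inequalities being strict. Solution concepts. A restricted-generalized-center is an optimal solution of $\min\{F_c(\mathcal S)-F_m(\mathcal S):\mathcal S\in\mathcal{PO}^\alpha_2\}$. A $\lambda$-restricted-cent-dian is an optimal solution of $\min\{H_\lambda(\mathcal S):\mathcal S\in\mathcal{PO}^\alpha_2\}$. A lexicographic cent-dian is an optimal solution of $\operatorname{lex}\min\{[F_c(\mathcal S),F_m(\mathcal S)]:\mathcal S\in\mathcal N^\alpha\}$, i.e. a subgraph minimizing $F_m$ among all minimizers of $F_c$ over $\mathcal N^\alpha$. *)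

theory Defs
  imports "Graph_Theory.Shortest_Path" "Graph_Theory.Pair_Digraph"
begin

text \<open>An undirected edge between \<open>i\<close> and \<open>j\<close> is the two-element set \<open>{i, j}\<close>; the two arcs it gives
  rise to are the pairs \<open>(i, j)\<close> and \<open>(j, i)\<close>, whose lengths may differ.\<close>

record 'v network =
  nodes :: "'v set"
  edges :: "'v set set"
  node_cost :: "'v \<Rightarrow> real"
  edge_cost :: "'v set \<Rightarrow> real"
  arc_length :: "'v \<times> 'v \<Rightarrow> real"
  od_pairs :: "('v \<times> 'v) set"
  demand :: "'v \<times> 'v \<Rightarrow> real"
  utility :: "'v \<times> 'v \<Rightarrow> real"

locale network_design =
  fixes I :: "'v network"
  assumes finite_nodes: "finite (nodes I)"
    and edges_subset: "e \<in> edges I \<Longrightarrow> e \<subseteq> nodes I \<and> card e = 2"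
    and node_cost_nonneg: "i \<in> nodes I \<Longrightarrow> 0 \<le> node_cost I i"
    and edge_cost_nonneg: "e \<in> edges I \<Longrightarrow> 0 \<le> edge_cost I e"
    and arc_length_nonneg: "{i, j} \<in> edges I \<Longrightarrow> 0 \<le> arc_length I (i, j)"
    and od_pairs_subset: "od_pairs I \<subseteq> nodes I \<times> nodes I"
    and finite_od_pairs: "finite (od_pairs I)"
    and od_pairs_nonempty: "od_pairs I \<noteq> {}"
    and od_pairs_distinct: "w \<in> od_pairs I \<Longrightarrow> fst w \<noteq> snd w"
    and demand_pos: "w \<in> od_pairs I \<Longrightarrow> 0 < demand I w"
    and utility_pos: "w \<in> od_pairs I \<Longrightarrow> 0 < utility I w"

type_synonym 'v subgraph = "'v set \<times> 'v set set"

definition is_subgraph :: "'v network \<Rightarrow> 'v subgraph \<Rightarrow> bool" where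
  "is_subgraph I S \<longleftrightarrow>
     fst S \<subseteq> nodes I \<and> snd S \<subseteq> edges I \<and> (\<forall>e\<in>snd S. e \<subseteq> fst S)"

definition cost :: "'v network \<Rightarrow> 'v subgraph \<Rightarrow> real" where
  "cost I S = (\<Sum>i\<in>fst S. node_cost I i) + (\<Sum>e\<in>snd S. edge_cost I e)"

definition feasible :: "'v network \<Rightarrow> real \<Rightarrow> 'v subgraph set" where
  "feasible I \<alpha> = {S. is_subgraph I S \<and> cost I S \<le> \<alpha> * cost I (nodes I, edges I)}"

definition arc_graph :: "'v subgraph \<Rightarrow> 'v pair_pre_digraph" where
  "arc_graph S = \<lparr> pverts = fst S, parcs = {(i, j). {i, j} \<in> snd S} \<rparr>"

text \<open>The library's shortest-path distance, equal to \<open>\<infinity>\<close> if there is no path. It is an infimum over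
  all walks; the lemma \<open>dist_attained\<close> below confirms that, lengths being nonnegative, it is the
  length of a shortest path whenever there is a path.\<close>

definition dist_in :: "'v network \<Rightarrow> 'v subgraph \<Rightarrow> 'v \<times> 'v \<Rightarrow> ereal" where
  "dist_in I S w = wf_digraph.\<mu> (with_proj (arc_graph S)) (arc_length I) (fst w) (snd w)"

definition travel_length :: "'v network \<Rightarrow> 'v subgraph \<Rightarrow> 'v \<times> 'v \<Rightarrow> real" where
  "travel_length I S w = real_of_ereal (min (dist_in I S w) (ereal (utility I w)))"

definition median_obj :: "'v network \<Rightarrow> 'v subgraph \<Rightarrow> real" where
  "median_obj I S =
     1 / (\<Sum>w\<in>od_pairs I. demand I w) * (\<Sum>w\<in>od_pairs I. demand I w * travel_length I S w)"

definition center_obj :: "'v network \<Rightarrow> 'v subgraph \<Rightarrow> real" where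
  "center_obj I S = Max (travel_length I S ` od_pairs I)"

definition cent_dian_obj :: "'v network \<Rightarrow> real \<Rightarrow> 'v subgraph \<Rightarrow> real" where
  "cent_dian_obj I l S = l * center_obj I S + (1 - l) * median_obj I S"

definition pareto_optimal :: "'v network \<Rightarrow> real \<Rightarrow> 'v subgraph set" where
  "pareto_optimal I \<alpha> = {S \<in> feasible I \<alpha>. \<not> (\<exists>S'\<in>feasible I \<alpha>.
     median_obj I S' \<le> median_obj I S \<and> center_obj I S' \<le> center_obj I S \<and>
     (median_obj I S' < median_obj I S \<or> center_obj I S' < center_obj I S))}"

definition restricted_generalized_center :: "'v network \<Rightarrow> real \<Rightarrow> 'v subgraph \<Rightarrow> bool" where
  "restricted_generalized_center I \<alpha> =
     is_arg_min (\<lambda>S. center_obj I S - median_obj I S) (\<lambda>S. S \<in> pareto_optimal I \<alpha>)"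

definition restricted_cent_dian :: "'v network \<Rightarrow> real \<Rightarrow> real \<Rightarrow> 'v subgraph \<Rightarrow> bool" where
  "restricted_cent_dian I \<alpha> l =
     is_arg_min (cent_dian_obj I l) (\<lambda>S. S \<in> pareto_optimal I \<alpha>)"

definition lexicographic_cent_dian :: "'v network \<Rightarrow> real \<Rightarrow> 'v subgraph \<Rightarrow> bool" where
  "lexicographic_cent_dian I \<alpha> =
     is_arg_min (median_obj I) (is_arg_min (center_obj I) (\<lambda>S. S \<in> feasible I \<alpha>))"

context network_design
begin

lemma fin_digraph_arc_graph:
  assumes S: "is_subgraph I S"
  shows "fin_digraph (with_proj (arc_graph S))"
proof -
  have fin: "finite (fst S)"
    using S finite_nodes by (auto simp: is_subgraph_def intro: finite_subset)
  have sub: "{(i, j). {i, j} \<in> snd S} \<subseteq> fst S \<times> fst S"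
    using S by (auto simp: is_subgraph_def)
  then have "finite {(i, j). {i, j} \<in> snd S}"
    using fin by (meson finite_SigmaI finite_subset)
  with fin sub show ?thesis
    by unfold_locales (auto simp: arc_graph_def)
qed

lemma dist_attained:
  assumes S: "is_subgraph I S"
  defines "D \<equiv> with_proj (arc_graph S)"
  shows "dist_in I S (s, t) < \<infinity> \<longleftrightarrow> (\<exists>p. pre_digraph.apath D s p t)"
    and "dist_in I S (s, t) < \<infinity> \<Longrightarrow> \<exists>p. pre_digraph.apath D s p t \<and>
           dist_in I S (s, t) = ereal (sum_list (map (arc_length I) p))"
    and "pre_digraph.apath D s p t \<Longrightarrow>
           dist_in I S (s, t) \<le> ereal (sum_list (map (arc_length I) p))"
proof -
  interpret fin_digraph D
    unfolding D_def by (rule fin_digraph_arc_graph[OF S])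
  have dist: "dist_in I S (s, t) = \<mu> (arc_length I) s t"
    by (simp add: dist_in_def D_def)
  have nonneg: "0 \<le> arc_length I a" if "a \<in> arcs D" for a
    using that S arc_length_nonneg by (auto simp: D_def arc_graph_def is_subgraph_def)
  show "dist_in I S (s, t) < \<infinity> \<longleftrightarrow> (\<exists>p. apath s p t)"
    unfolding dist \<mu>_reach_conv reachable_awalk
    by (meson apath_awalk_to_apath apath_def)
  show "\<exists>p. apath s p t \<and> dist_in I S (s, t) = ereal (sum_list (map (arc_length I) p))"
    if "dist_in I S (s, t) < \<infinity>"
  proof -
    have "s \<rightarrow>\<^sup>*\<^bsub>D\<^esub> t" using that unfolding dist \<mu>_reach_conv .
    moreover have "\<not> awalk_cost (arc_length I) c < 0" if "awalk w c w" for w c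
      using pos_cost_pos_awalk_cost[OF that nonneg] by (simp add: not_less)
    ultimately show ?thesis
      using no_neg_cyc_reach_imp_path[of s t "arc_length I"] by (auto simp: dist awalk_cost_def)
  qed
  show "dist_in I S (s, t) \<le> ereal (sum_list (map (arc_length I) p))" if "apath s p t"
    using that min_cost_le_walk_cost[of s p t "arc_length I"]
    by (simp add: dist awalk_cost_def apath_def)
qed

end

end

theory Submission
  imports Defs
begin

text \<open>The argument is one about two real objectives on a finite nonempty set. Fix a
  lexicographic minimizer \<open>L\<close> (smallest center value, ties broken by the median). It is Pareto-optimal, and it is an endpoint of the Pareto front: a Pareto-optimal \<open>S\<close>
  either has the same two values as \<open>L\<close>, or it has a strictly larger center value, for which it must be
  compensated by a strictly smaller median value (\<open>pareto_versus_lex_min\<close>). In the second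
  case every combination that rewards a small center and does not reward a small median, that is
  \<open>p * center + q * median\<close> with \<open>p > 0\<close> and \<open>q \<le> 0\<close>, is strictly larger at \<open>S\<close> than at \<open>L\<close>. Hence the
  minimizers over the Pareto set are exactly the points with the values of \<open>L\<close>, which are the
  lexicographic minimizers (\<open>pareto_arg_min_iff_lex_min\<close>). The coefficients \<open>(1, -1)\<close> give
  the restricted-generalized-center, and \<open>(l, 1 - l)\<close> with \<open>l \<ge> 1\<close> give the restricted cent-dian.

  An \<open>L\<close> exists because a finite graph has finitely many subgraphs, and because the empty
  subgraph, having cost 0, satisfies every budget.\<close>

definition pareto_set :: "('a \<Rightarrow> 'b::linorder) \<Rightarrow> ('a \<Rightarrow> 'c::linorder) \<Rightarrow> 'a set \<Rightarrow> 'a set" where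
  "pareto_set m c X =
     {x \<in> X. \<not> (\<exists>y\<in>X. m y \<le> m x \<and> c y \<le> c x \<and> (m y < m x \<or> c y < c x))}"

definition lex_min :: "('a \<Rightarrow> 'b::linorder) \<Rightarrow> ('a \<Rightarrow> 'c::linorder) \<Rightarrow> 'a set \<Rightarrow> 'a \<Rightarrow> bool" where
  "lex_min m c X = is_arg_min m (is_arg_min c (\<lambda>x. x \<in> X))"

lemma lex_min_iff:
  "lex_min m c X x \<longleftrightarrow>
     x \<in> X \<and> (\<forall>y\<in>X. c x < c y \<or> c x = c y \<and> m x \<le> m y)"
proof
  assume x: "lex_min m c X x"
  then have center: "c x \<le> c y" if "y \<in> X" for y
    using that by (auto simp: lex_min_def is_arg_min_linorder)
  have "m x \<le> m y" if "y \<in> X" "c x = c y" for y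
    using x that by (auto simp: lex_min_def is_arg_min_linorder)
  then show "x \<in> X \<and> (\<forall>y\<in>X. c x < c y \<or> c x = c y \<and> m x \<le> m y)"
    using x center by (auto simp: lex_min_def is_arg_min_linorder order_le_less)
next
  assume "x \<in> X \<and> (\<forall>y\<in>X. c x < c y \<or> c x = c y \<and> m x \<le> m y)"
  then show "lex_min m c X x"
    unfolding lex_min_def is_arg_min_linorder by (force simp: order_le_less)
qed

lemma ex_lex_min:
  assumes "finite X" "X \<noteq> {}"
  shows "\<exists>x. lex_min m c X x"
proof -
  define Y where "Y = {x. is_arg_min c (\<lambda>x. x \<in> X) x}"
  have "finite Y" "Y \<noteq> {}"
    using assms ex_is_arg_min_if_finite[of X c]
    by (auto simp: Y_def is_arg_min_def)
  then show ?thesis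
    using ex_is_arg_min_if_finite[of Y m] by (auto simp: Y_def lex_min_def)
qed

lemma lex_min_pareto:
  assumes "lex_min m c X x"
  shows "x \<in> pareto_set m c X"
  using assms unfolding lex_min_iff pareto_set_def by fastforce

text \<open>If neither alternative held, the lexicographic minimizer \<open>z\<close> would dominate \<open>x\<close>.\<close>

lemma pareto_versus_lex_min:
  assumes "lex_min m c X z" "x \<in> pareto_set m c X"
  shows "c x = c z \<and> m x = m z \<or> c z < c x \<and> m x < m z"
  using assms unfolding lex_min_iff pareto_set_def by force

text \<open>The sign conditions make both terms of the objective move in favour of the lexicographic
  minimizer; \<open>q = 0\<close> is harmless, because by \<open>pareto_versus_lex_min\<close> the values of \<open>c\<close> already
  differ strictly whenever the values of the pair \<open>(c, m)\<close> do.\<close>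

lemma pareto_arg_min_iff_lex_min:
  fixes m c :: "'a \<Rightarrow> 'b::linordered_idom"
  assumes "finite X" "X \<noteq> {}" and "0 < p" "q \<le> 0"
  shows "is_arg_min (\<lambda>x. p * c x + q * m x) (\<lambda>x. x \<in> pareto_set m c X) x \<longleftrightarrow> lex_min m c X x"
    (is "is_arg_min ?h _ x \<longleftrightarrow> _")
proof -
  have gap: "c y = c z \<and> m y = m z \<or> ?h z < ?h y"
    if z: "lex_min m c X z" and y: "y \<in> pareto_set m c X" for y z
    using pareto_versus_lex_min[OF z y] assms(3,4)
    by (auto intro!: add_less_le_mono mult_strict_left_mono mult_left_mono_neg)
  show ?thesis
  proof
    assume x: "is_arg_min ?h (\<lambda>x. x \<in> pareto_set m c X) x"
    obtain z where z: "lex_min m c X z"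
      using ex_lex_min[OF assms(1,2)] by blast
    have xP: "x \<in> pareto_set m c X" and "\<not> ?h z < ?h x"
      using x lex_min_pareto[OF z] by (auto simp: is_arg_min_def)
    then have "c x = c z" "m x = m z"
      using gap[OF z xP] by auto
    moreover have "x \<in> X"
      using xP by (simp add: pareto_set_def)
    ultimately show "lex_min m c X x"
      using z by (simp add: lex_min_iff)
  next
    assume x: "lex_min m c X x"
    then show "is_arg_min ?h (\<lambda>x. x \<in> pareto_set m c X) x"
      using gap[OF x] lex_min_pareto[OF x] by (fastforce simp: is_arg_min_linorder)
  qed
qed

context network_design
begin

lemma finite_feasible: "finite (feasible I \<alpha>)"
proof -
  have "finite (edges I)"
    by (rule finite_subset[of _ "Pow (nodes I)"]) (use finite_nodes edges_subset in auto)
  then have "finite (Pow (nodes I) \<times> Pow (edges I))"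
    using finite_nodes by simp
  then show ?thesis
    by (rule rev_finite_subset) (auto simp: feasible_def is_subgraph_def)
qed

lemma feasible_nonempty:
  assumes "0 \<le> \<alpha>"
  shows "feasible I \<alpha> \<noteq> {}"
proof -
  have "0 \<le> cost I (nodes I, edges I)"
    by (auto simp: cost_def intro!: add_nonneg_nonneg sum_nonneg node_cost_nonneg edge_cost_nonneg)
  then have "({}, {}) \<in> feasible I \<alpha>"
    using assms by (simp add: feasible_def is_subgraph_def cost_def)
  then show ?thesis by blast
qed

end

theorem proposition2:
  fixes I :: "'v network" and \<alpha> l :: real
  assumes "network_design I"
    and "0 \<le> \<alpha>" "\<alpha> \<le> 1"
    and "1 \<le> l"
  shows "(\<forall>S. restricted_generalized_center I \<alpha> S \<longrightarrow> lexicographic_cent_dian I \<alpha> S) \<and>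
         (\<forall>S. restricted_cent_dian I \<alpha> l S \<longrightarrow> lexicographic_cent_dian I \<alpha> S) \<and>
         (\<forall>S. lexicographic_cent_dian I \<alpha> S \<longrightarrow>
              restricted_generalized_center I \<alpha> S \<and> restricted_cent_dian I \<alpha> l S)"
proof -
  interpret network_design I by fact
  let ?m = "median_obj I" and ?c = "center_obj I" and ?X = "feasible I \<alpha>"
  have pareto: "pareto_optimal I \<alpha> = pareto_set ?m ?c ?X"
    by (simp add: pareto_optimal_def pareto_set_def)
  have lex: "lexicographic_cent_dian I \<alpha> S \<longleftrightarrow> lex_min ?m ?c ?X S" for S
    by (simp add: lexicographic_cent_dian_def lex_min_def)
  note iff = pareto_arg_min_iff_lex_min[OF finite_feasible feasible_nonempty[OF assms(2)]]
  have "restricted_generalized_center I \<alpha> S \<longleftrightarrow> lexicographic_cent_dian I \<alpha> S" for S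
    using iff[of 1 "-1" ?c ?m S]
    by (simp add: restricted_generalized_center_def pareto lex)
  moreover have "restricted_cent_dian I \<alpha> l S \<longleftrightarrow> lexicographic_cent_dian I \<alpha> S" for S
    using iff[of l "1 - l" ?c ?m S] assms(4)
    by (simp add: restricted_cent_dian_def cent_dian_obj_def[abs_def] pareto lex)
  ultimately show ?thesis by blast
qed

end
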